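(* Let $(X,\to,0,1)$ be an implicative-orthomodular algebra. Every strongly maximal filter of $X$ is maximal.
   Context: A BE algebra is an algebra $(X,\to,1)$ of type $(2,0)$ such that for all $x,y,z\in X$: $x\to x=1$; $x\to 1=1$; $1\to x=x$; $x\to(y\to z)=y\to(x\to z)$. Put $x\le y$ iff $x\to y=1$. It is bounded if there is $0\in X$ with $0\le x$ for all $x\in X$; then $x^*:=x\to 0$. It is involutive if it is bounded and $x^{**}=x$ for all $x$. In an involutive BE algebra $(X,\to,0,1)$ define $x\Cap y:=((x^*\to y^* )\to y^* )^*$, $x\odot y:=(x\to y^* )^*$ (a commutative and associative operation), and $x\le_Q y$ iff $x=x\Cap y$; $x^n$ denotes $x\odot\cdots\odot x$ ($n$ factors). An implicative-orthomodular algebra is an involutive BE algebra satisfying $x\Cap(y\to x)=x$ for all $x,y\in X$. A filter of $X$ is a nonempty $F\subseteq X$ such that $x,y\in F$ implies $x\odot y\in F$, and $x\in F$, $y\in X$, $x\le_Q y$ imply $y\in F$. A filter $F$ is proper if $F\ne X$. A filter is maximal if it is proper and is not contained in any other proper filter of $X$. A filter $F$ is strongly maximal if for every $x\in X$ with $x\notin F$ there exists $n\ge 1$ such that $(x^n)^*\in F$.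
   Formalization: The filter is additionally assumed to be proper, since the whole algebra X is vacuously a strongly maximal filter under the given definition but is not proper and hence not maximal. *)

theory Defs
  imports Main
begin

locale BE_algebra =
  fixes X :: "'a set"
    and imp :: "'a \<Rightarrow> 'a \<Rightarrow> 'a" (infixr "\<rightarrow>" 65)
    and one :: "'a" ("\<one>")
  assumes imp_closed: "\<lbrakk>x \<in> X; y \<in> X\<rbrakk> \<Longrightarrow> x \<rightarrow> y \<in> X"
    and one_closed: "\<one> \<in> X"
    and imp_refl: "x \<in> X \<Longrightarrow> x \<rightarrow> x = \<one>"
    and imp_one: "x \<in> X \<Longrightarrow> x \<rightarrow> \<one> = \<one>"
    and one_imp: "x \<in> X \<Longrightarrow> \<one> \<rightarrow> x = x"
    and imp_exchange:
      "\<lbrakk>x \<in> X; y \<in> X; z \<in> X\<rbrakk> \<Longrightarrow> x \<rightarrow> (y \<rightarrow> z) = y \<rightarrow> (x \<rightarrow> z)"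
begin

definition le :: "'a \<Rightarrow> 'a \<Rightarrow> bool" (infix "\<preceq>" 50)
  where "x \<preceq> y \<longleftrightarrow> x \<rightarrow> y = \<one>"

end

locale bounded_BE_algebra = BE_algebra X imp one
  for X :: "'a set"
    and imp :: "'a \<Rightarrow> 'a \<Rightarrow> 'a" (infixr "\<rightarrow>" 65)
    and zero :: "'a" ("\<zero>")
    and one :: "'a" ("\<one>") +
  assumes zero_closed: "\<zero> \<in> X"
    and zero_le: "x \<in> X \<Longrightarrow> \<zero> \<preceq> x"
begin

definition star :: "'a \<Rightarrow> 'a" ("_\<^sup>\<star>" [1000] 999)
  where "x\<^sup>\<star> = x \<rightarrow> \<zero>"

end

locale involutive_BE_algebra = bounded_BE_algebra +
  assumes star_star: "x \<in> X \<Longrightarrow> (x\<^sup>\<star>)\<^sup>\<star> = x"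
begin

definition Cap :: "'a \<Rightarrow> 'a \<Rightarrow> 'a" (infixl "\<Cap>" 70)
  where "x \<Cap> y = ((x\<^sup>\<star> \<rightarrow> y\<^sup>\<star>) \<rightarrow> y\<^sup>\<star>)\<^sup>\<star>"

definition odot :: "'a \<Rightarrow> 'a \<Rightarrow> 'a" (infixl "\<odot>" 70)
  where "x \<odot> y = (x \<rightarrow> y\<^sup>\<star>)\<^sup>\<star>"

definition le_Q :: "'a \<Rightarrow> 'a \<Rightarrow> bool" (infix "\<preceq>\<^sub>Q" 50)
  where "x \<preceq>\<^sub>Q y \<longleftrightarrow> x = x \<Cap> y"

text \<open>The value at exponent 0 is a convention; only positive exponents are used below.\<close>

fun odot_pow :: "'a \<Rightarrow> nat \<Rightarrow> 'a"
  where
    "odot_pow x 0 = \<one>"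
  | "odot_pow x (Suc 0) = x"
  | "odot_pow x (Suc (Suc n)) = odot_pow x (Suc n) \<odot> x"

definition is_filter :: "'a set \<Rightarrow> bool"
  where "is_filter F \<longleftrightarrow>
    F \<subseteq> X \<and> F \<noteq> {} \<and>
    (\<forall>x\<in>F. \<forall>y\<in>F. x \<odot> y \<in> F) \<and>
    (\<forall>x\<in>F. \<forall>y\<in>X. x \<preceq>\<^sub>Q y \<longrightarrow> y \<in> F)"

definition proper_filter :: "'a set \<Rightarrow> bool"
  where "proper_filter F \<longleftrightarrow> is_filter F \<and> F \<noteq> X"

definition maximal_filter :: "'a set \<Rightarrow> bool"
  where "maximal_filter F \<longleftrightarrow>
    proper_filter F \<and> \<not> (\<exists>G. proper_filter G \<and> F \<subset> G)"

text \<open>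
  Properness is not part of this definition, so the improper filter \<open>X\<close> satisfies it
  vacuously, although it is never maximal.  Results of the form "strongly maximal implies
  maximal" are therefore about proper filters.
\<close>

definition strongly_maximal_filter :: "'a set \<Rightarrow> bool"
  where "strongly_maximal_filter F \<longleftrightarrow>
    is_filter F \<and> (\<forall>x\<in>X. x \<notin> F \<longrightarrow> (\<exists>n\<ge>1. (odot_pow x n)\<^sup>\<star> \<in> F))"

end

locale implicative_orthomodular_algebra = involutive_BE_algebra +
  assumes implicative_orthomodular: "\<lbrakk>x \<in> X; y \<in> X\<rbrakk> \<Longrightarrow> x \<Cap> (y \<rightarrow> x) = x"

end

theory Submission
  imports Defs
begin

text \<open>
  Suppose a filter \<open>G\<close> is strictly larger than a strongly maximal filter \<open>F\<close>, and pick
  \<open>x \<in> G - F\<close>. Strong maximality puts the complement of some power \<open>x\<^sup>n\<close> into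
  \<open>F \<subseteq> G\<close>, while \<open>x\<^sup>n\<close> itself lies in \<open>G\<close> by closure under products. Thus \<open>G\<close> contains
  an element together with its complement, whose product is \<open>\<zero>\<close>
  (lemma \<open>odot_star_self\<close>). Since \<open>\<zero>\<close> is the least element for \<open>\<preceq>\<^sub>Q\<close>
  (lemma \<open>zero_le_Q\<close>), \<open>G\<close> is everything.
\<close>

context involutive_BE_algebra
begin

lemma star_closed: "x \<in> X \<Longrightarrow> x\<^sup>\<star> \<in> X"
  by (simp add: star_def imp_closed zero_closed)

lemma star_zero: "\<zero>\<^sup>\<star> = \<one>"
  by (simp add: star_def imp_refl zero_closed)

lemma star_one: "\<one>\<^sup>\<star> = \<zero>"
  by (simp add: star_def one_imp zero_closed)

lemma odot_star_self: "x \<in> X \<Longrightarrow> x \<odot> x\<^sup>\<star> = \<zero>"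
  by (simp add: odot_def star_star imp_refl star_one)

text \<open>
  The order \<open>\<preceq>\<^sub>Q\<close> is defined by \<open>\<Cap>\<close> rather than by \<open>\<rightarrow>\<close>, so that \<open>\<zero>\<close> is its least
  element is not the boundedness axiom; it holds because \<open>\<zero>\<^sup>\<star> = \<one>\<close> is a left unit
  of \<open>\<rightarrow>\<close>, which collapses \<open>\<zero> \<Cap> y\<close> to \<open>(y\<^sup>\<star> \<rightarrow> y\<^sup>\<star>)\<^sup>\<star>\<close>.
\<close>

lemma zero_le_Q: "y \<in> X \<Longrightarrow> \<zero> \<preceq>\<^sub>Q y"
  by (simp add: le_Q_def Cap_def star_zero star_closed one_imp imp_refl star_one)

lemma filter_odot_pow:
  assumes "is_filter G" "x \<in> G"
  shows "odot_pow x (Suc n) \<in> G"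
  using assms by (induction n) (auto simp: is_filter_def)

lemma filter_with_complementary_pair_eq_carrier:
  assumes G: "is_filter G" and x: "x \<in> G" "x\<^sup>\<star> \<in> G"
  shows "G = X"
proof -
  have "x \<in> X" using G x by (auto simp: is_filter_def)
  then have "\<zero> \<in> G"
    using G x odot_star_self unfolding is_filter_def by metis
  then show ?thesis
    using G zero_le_Q unfolding is_filter_def by blast
qed

lemma strongly_maximal_imp_maximal:
  assumes F: "strongly_maximal_filter F" and proper: "proper_filter F"
  shows "maximal_filter F"
proof -
  have False if G: "proper_filter G" and "F \<subset> G" for G
  proof -
    have filt: "is_filter G" and "G \<noteq> X" using G by (auto simp: proper_filter_def)
    obtain x where x: "x \<in> G" "x \<notin> F" using \<open>F \<subset> G\<close> by blast
    then have "x \<in> X" using filt by (auto simp: is_filter_def)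
    then obtain n where n: "n \<ge> 1" "(odot_pow x n)\<^sup>\<star> \<in> F"
      using F x unfolding strongly_maximal_filter_def by blast
    have "odot_pow x n \<in> G"
      using filter_odot_pow[OF filt x(1), of "n - 1"] n(1) by simp
    moreover have "(odot_pow x n)\<^sup>\<star> \<in> G" using n(2) \<open>F \<subset> G\<close> by blast
    ultimately show False
      using filter_with_complementary_pair_eq_carrier[OF filt] \<open>G \<noteq> X\<close> by blast
  qed
  then show ?thesis using proper unfolding maximal_filter_def by blast
qed

end

theorem proposition4p10:
  fixes X :: "'a set" and imp :: "'a \<Rightarrow> 'a \<Rightarrow> 'a" and zero one :: 'a and F :: "'a set"
  assumes "implicative_orthomodular_algebra X imp zero one"
    and "involutive_BE_algebra.strongly_maximal_filter X imp zero one F"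
    and "involutive_BE_algebra.proper_filter X imp zero F"
  shows "involutive_BE_algebra.maximal_filter X imp zero F"
proof -
  interpret implicative_orthomodular_algebra X imp zero one by (fact assms(1))
  show ?thesis using assms(2,3) by (rule strongly_maximal_imp_maximal)
qed

end
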